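(* Suppose that the random measure $G$ satisfies the Ghirlanda-Guerra identities. Let $n\geq 1$ and let $B_1,\ldots,B_n\subseteq\mathbb{R}$ be measurable sets such that $\mu(B_l)>0$ for at least one $l\leq n$. Then, with probability one over the choice of $G$, for $G^{\otimes n}$-almost all $(\sigma^1,\ldots,\sigma^n)$ the following holds: if $R_{l,l'}\in B_l\cap B_{l'}$ for all $l\neq l'$, $l,l'\le n$, then the set of $\sigma$ such that $\sigma\cdot\sigma^l\in B_l$ for all $l\leq n$ has positive $G$-measure.
   Context: $G$ is a random probability measure on the unit ball of a separable Hilbert space $H$; $(\sigma^l)_{l\geq 1}$ is an i.i.d. sequence from $G$; $\langle\cdot\rangle$ is the average with respect to $G^{\otimes\infty}$; $\mathbb{E}$ is the expectation with respect to the randomness of $G$. $R_{l,l'}=\sigma^l\cdot\sigma^{l'}$ is the scalar product (overlap), and $\mu$ is the law of $R_{1,2}$ under $\mathbb{E}G^{\otimes 2}$. Ghirlanda-Guerra identities: for any $n\geq 2$, any bounded measurable function $f$ of the overlaps $(R_{l,l'})_{l,l'\leq n}$ and any bounded measurable function $\psi$ of one overlap, $$\mathbb{E}\langle f\psi(R_{1,n+1})\rangle=\frac1n\,\mathbb{E}\langle f\rangle\,\mathbb{E}\langle\psi(R_{1,2})\rangle+\frac1n\sum_{l=2}^n\mathbb{E}\langle f\psi(R_{1,l})\rangle .$$ *)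

theory Defs
  imports "HOL-Probability.Probability"
begin

definition unit_ball :: "'h::{real_inner, polish_space} measure" where
  "unit_ball = restrict_space borel (cball 0 1)"

text \<open>
  A real Hilbert space is a complete \<^typ>\<open>'h::real_inner\<close>; the class \<open>polish_space\<close> adds
  completeness and separability. A random measure is a measurable map into the space of
  probability measures on the closed unit ball.
\<close>

definition random_prob_measure ::
  "'w measure \<Rightarrow> ('w \<Rightarrow> 'h::{real_inner, polish_space} measure) \<Rightarrow> bool" where
  "random_prob_measure P G \<longleftrightarrow> prob_space P \<and> G \<in> measurable P (prob_algebra unit_ball)"

text \<open>
  Replicas are numbered from 1, so a sample is a function whose values at \<open>l \<ge> 1\<close> are the
  \<open>\<sigma>\<^sup>l\<close>.
\<close>

definition replicas :: "nat set \<Rightarrow> 'h measure \<Rightarrow> (nat \<Rightarrow> 'h) measure" where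
  "replicas I M = (\<Pi>\<^sub>M l\<in>I. M)"

definition averaged_expectation ::
  "'w measure \<Rightarrow> ('w \<Rightarrow> 'h measure) \<Rightarrow> ((nat \<Rightarrow> 'h) \<Rightarrow> real) \<Rightarrow> real" where
  "averaged_expectation P G F = (\<integral>\<omega>. (\<integral>\<sigma>. F \<sigma> \<partial>replicas {1..} (G \<omega>)) \<partial>P)"

definition overlap :: "(nat \<Rightarrow> 'h::real_inner) \<Rightarrow> nat \<Rightarrow> nat \<Rightarrow> real" where
  "overlap \<sigma> l l' = \<sigma> l \<bullet> \<sigma> l'"

definition overlap_array :: "nat \<Rightarrow> (nat \<Rightarrow> 'h::real_inner) \<Rightarrow> nat \<times> nat \<Rightarrow> real" where
  "overlap_array n \<sigma> = (\<lambda>(l, l') \<in> {1..n} \<times> {1..n}. overlap \<sigma> l l')"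

definition overlap_law ::
  "'w measure \<Rightarrow> ('w \<Rightarrow> 'h::{real_inner, polish_space} measure) \<Rightarrow> real measure" where
  "overlap_law P G =
     distr (P \<bind> (\<lambda>\<omega>. replicas {1..2} (G \<omega>))) borel (\<lambda>\<sigma>. overlap \<sigma> 1 2)"

definition ghirlanda_guerra ::
  "'w measure \<Rightarrow> ('w \<Rightarrow> 'h::{real_inner, polish_space} measure) \<Rightarrow> bool" where
  "ghirlanda_guerra P G \<longleftrightarrow>
     (\<forall>n\<ge>2. \<forall>f \<in> borel_measurable (\<Pi>\<^sub>M p\<in>{1..n} \<times> {1..n}. (borel :: real measure)).
        \<forall>\<psi> \<in> borel_measurable (borel :: real measure).
        bounded (range f) \<longrightarrow> bounded (range \<psi>) \<longrightarrow>
        averaged_expectation P G (\<lambda>\<sigma>. f (overlap_array n \<sigma>) * \<psi> (overlap \<sigma> 1 (n + 1))) =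
          1 / real n * averaged_expectation P G (\<lambda>\<sigma>. f (overlap_array n \<sigma>))
            * averaged_expectation P G (\<lambda>\<sigma>. \<psi> (overlap \<sigma> 1 2))
          + 1 / real n * (\<Sum>l = 2..n.
              averaged_expectation P G
                (\<lambda>\<sigma>. f (overlap_array n \<sigma>) * \<psi> (overlap \<sigma> 1 l))))"

end

theory Submission
  imports Defs
begin

text \<open>
  Let \<open>Q\<close> be the law of the whole sequence of replicas, averaged over the randomness of \<open>G\<close>, and
  say that replica \<open>i\<close> misses if \<open>R\<^bsub>l,i\<^esub> \<notin> B\<^sub>l\<close> for some \<open>l \<le> n\<close>. Let \<open>A\<^sub>k\<close> be the event that the
  first \<open>n\<close> replicas satisfy \<open>R\<^bsub>l,l'\<^esub> \<in> B\<^sub>l \<inter> B\<^bsub>l'\<^esub>\<close> for \<open>l \<noteq> l'\<close> and the next \<open>k\<close> replicas all miss. If,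
  for a given sample of the first \<open>n\<close> replicas, the hitting set
  \<open>{\<tau>. \<tau> \<bullet> \<sigma>\<^sup>l \<in> B\<^sub>l for all l \<le> n}\<close> is \<open>G\<close>-null, then all later replicas miss almost surely. So it
  suffices to show that \<open>Q(A\<^sub>k) \<rightarrow> 0\<close>.

  Let \<open>d\<^sub>k\<close> be the sum over \<open>l \<le> n\<close> of \<open>Q(A\<^sub>k and R\<^bsub>l,n+k+1\<^esub> \<notin> B\<^sub>l)\<close>. The union bound gives
  \<open>Q(A\<^bsub>k+1\<^esub>) \<le> d\<^sub>k\<close>. Apply the Ghirlanda-Guerra identity for \<open>n + k + 1\<close> replicas to the event
  \<open>A\<^bsub>k+1\<^esub>\<close> and the complement of \<open>B\<^sub>l\<close>, with replica \<open>l\<close> in the role of the first one, and sum over \<open>l\<close>.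
  On \<open>A\<^bsub>k+1\<^esub>\<close> the overlaps among the first \<open>n\<close> replicas contribute nothing, and by
  exchangeability each of the \<open>k + 1\<close> missing replicas contributes \<open>d\<^sub>k\<close>. With \<open>m = \<Sum>\<^sub>l \<mu>(B\<^sub>l)\<close>, where
  \<open>0 < m \<le> n\<close>, this reads
  \<open>(n + k + 1) d\<^bsub>k+1\<^esub> = (n - m) Q(A\<^bsub>k+1\<^esub>) + (k + 1) d\<^sub>k \<le> (n + k + 1 - m) d\<^sub>k\<close>,
  and the divergence of the harmonic series forces \<open>d\<^sub>k \<rightarrow> 0\<close> (\<open>harmonic_recursion_tendsto_0\<close>,
  \<open>barren_null\<close>).
\<close>

section \<open>A recursion of harmonic type\<close>

lemma harmonic_recursion_tendsto_0:
  fixes d :: "nat \<Rightarrow> real" and m :: real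
  assumes "0 < m" and "1 \<le> a"
    and nonneg: "\<And>k. 0 \<le> d k"
    and rec: "\<And>k. real (a + k) * d (Suc k) \<le> (real (a + k) - m) * d k"
  shows "d \<longlonglongrightarrow> 0"
proof -
  have drop: "m * d k / real (a + k) \<le> d k - d (Suc k)" for k
    using rec[of k] \<open>1 \<le> a\<close> by (simp add: divide_simps algebra_simps)
  have "decseq d"
  proof (rule decseq_SucI)
    fix k
    have "0 \<le> m * d k / real (a + k)"
      using \<open>0 < m\<close> nonneg[of k] by simp
    with drop[of k] show "d (Suc k) \<le> d k" by linarith
  qed
  then obtain L where L: "d \<longlonglongrightarrow> L" and L_le: "\<And>k. L \<le> d k"
    using decseq_convergent[of d 0] nonneg by blast
  have "L = 0"
  proof (rule ccontr)
    assume "L \<noteq> 0"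
    with L nonneg have "0 < L"
      using LIMSEQ_le_const[of d L 0] by force
    have "summable (\<lambda>k. d k - d (Suc k))"
      by (rule telescope_summable'[OF L])
    then have "summable (\<lambda>k. m * L * inverse (real (k + a)))"
    proof (rule summable_comparison_test'[where N = 0])
      fix k
      have "m * L * inverse (real (k + a)) \<le> m * d k / real (a + k)"
        using L_le[of k] \<open>0 < m\<close> \<open>1 \<le> a\<close> by (simp add: divide_simps add.commute)
      also note drop[of k]
      finally show "norm (m * L * inverse (real (k + a))) \<le> d k - d (Suc k)"
        using \<open>0 < m\<close> \<open>0 < L\<close> by simp
    qed
    then have "summable (\<lambda>k. inverse (real (k + a)))"
      using \<open>0 < m\<close> \<open>0 < L\<close> summable_cmult_iff[of "m * L" "\<lambda>k. inverse (real (k + a))"] by simp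
    then have "summable (\<lambda>k. inverse (real k))"
      using summable_iff_shift[of "\<lambda>k. inverse (real k)" a] by simp
    then show False
      using not_summable_harmonic[where 'a = real] by simp
  qed
  with L show ?thesis by simp
qed

section \<open>Overlap events\<close>

text \<open>The hypothesis on the overlaps among the first \<open>n\<close> replicas.\<close>
definition mutual :: "(nat \<Rightarrow> real set) \<Rightarrow> nat \<Rightarrow> (nat \<Rightarrow> 'h::real_inner) \<Rightarrow> bool" where
  "mutual B n \<sigma> \<longleftrightarrow>
     (\<forall>l\<in>{1..n}. \<forall>l'\<in>{1..n}. l \<noteq> l' \<longrightarrow> overlap \<sigma> l l' \<in> B l \<inter> B l')"

text \<open>Replica \<open>i\<close> lies outside the set of \<open>\<tau>\<close> with \<open>\<tau> \<bullet> \<sigma>\<^sup>l \<in> B\<^sub>l\<close> for all \<open>l \<le> n\<close>.\<close>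
definition misses :: "(nat \<Rightarrow> real set) \<Rightarrow> nat \<Rightarrow> (nat \<Rightarrow> 'h::real_inner) \<Rightarrow> nat \<Rightarrow> bool" where
  "misses B n \<sigma> i \<longleftrightarrow> (\<exists>l\<in>{1..n}. overlap \<sigma> l i \<notin> B l)"

text \<open>
  The event \<open>A\<^sub>k\<close>: the overlap hypothesis holds and the \<open>k\<close> replicas after the first \<open>n\<close> all miss.
\<close>
definition barren :: "(nat \<Rightarrow> real set) \<Rightarrow> nat \<Rightarrow> nat \<Rightarrow> (nat \<Rightarrow> 'h::real_inner) \<Rightarrow> bool" where
  "barren B n k \<sigma> \<longleftrightarrow> mutual B n \<sigma> \<and> (\<forall>i\<in>{n+1..n+k}. misses B n \<sigma> i)"

lemma mutualD:
  "mutual B n \<sigma> \<Longrightarrow> l \<in> {1..n} \<Longrightarrow> l' \<in> {1..n} \<Longrightarrow> l \<noteq> l' \<Longrightarrow> overlap \<sigma> l l' \<in> B l"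
  unfolding mutual_def by blast

lemma barren_Suc: "barren B n (Suc k) \<sigma> \<longleftrightarrow> barren B n k \<sigma> \<and> misses B n \<sigma> (n + k + 1)"
  by (auto simp: barren_def atLeastAtMostSuc_conv)

lemma measurable_unit_ball [measurable]: "(\<lambda>x. x) \<in> unit_ball \<rightarrow>\<^sub>M borel"
  unfolding unit_ball_def by (rule measurable_restrict_space1) simp

lemma measurable_coordinate:
  "i \<in> I \<Longrightarrow> (\<lambda>\<sigma>. \<sigma> i) \<in> replicas I unit_ball \<rightarrow>\<^sub>M borel"
  unfolding replicas_def
  by (rule measurable_compose[OF _ measurable_unit_ball]) (rule measurable_component_singleton)

lemma measurable_overlap:
  "i \<in> I \<Longrightarrow> j \<in> I \<Longrightarrow> (\<lambda>\<sigma>. overlap \<sigma> i j) \<in> borel_measurable (replicas I unit_ball)"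
  unfolding overlap_def by (intro borel_measurable_inner measurable_coordinate)

lemma measurable_overlap_array:
  assumes "{1..N} \<subseteq> I"
  shows "overlap_array N \<in> replicas I unit_ball \<rightarrow>\<^sub>M (\<Pi>\<^sub>M p\<in>{1..N} \<times> {1..N}. borel)"
  unfolding overlap_array_def [abs_def] using assms
  by (intro measurable_restrict) (auto intro!: measurable_overlap)

lemma overlap_array_apply [simp]:
  "l \<in> {1..N} \<Longrightarrow> l' \<in> {1..N} \<Longrightarrow> overlap_array N \<sigma> (l, l') = overlap \<sigma> l l'"
  by (simp add: overlap_array_def)

text \<open>
  The set of \<open>(n + k) \<times> (n + k)\<close> overlap arrays that defines the event \<^const>\<open>barren\<close>; the
  Ghirlanda-Guerra identities speak about functions of such arrays.
\<close>
definition barren_arrays :: "(nat \<Rightarrow> real set) \<Rightarrow> nat \<Rightarrow> nat \<Rightarrow> (nat \<times> nat \<Rightarrow> real) set" where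
  "barren_arrays B n k = {r \<in> space (\<Pi>\<^sub>M p\<in>{1..n+k} \<times> {1..n+k}. borel).
     (\<forall>l\<in>{1..n}. \<forall>l'\<in>{1..n}. l \<noteq> l' \<longrightarrow> r (l, l') \<in> B l \<and> r (l, l') \<in> B l') \<and>
     (\<forall>i\<in>{n+1..n+k}. \<exists>l\<in>{1..n}. r (l, i) \<notin> B l)}"

lemma barren_iff_array: "barren B n k \<sigma> \<longleftrightarrow> overlap_array (n + k) \<sigma> \<in> barren_arrays B n k"
proof -
  have "overlap_array (n + k) \<sigma> \<in> space (\<Pi>\<^sub>M p\<in>{1..n+k} \<times> {1..n+k}. borel)"
    by (auto simp: space_PiM overlap_array_def)
  then show ?thesis
    by (simp add: barren_arrays_def barren_def mutual_def misses_def)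
qed

lemma sets_barren_arrays:
  assumes "\<And>l. l \<in> {1..n} \<Longrightarrow> B l \<in> sets borel"
  shows "barren_arrays B n k \<in> sets (\<Pi>\<^sub>M p\<in>{1..n+k} \<times> {1..n+k}. borel)"
proof -
  have *: "Measurable.pred (\<Pi>\<^sub>M p\<in>{1..n+k} \<times> {1..n+k}. borel) (\<lambda>r. r (l, l') \<in> B j)"
    if "l \<in> {1..n+k}" "l' \<in> {1..n+k}" "j \<in> {1..n}" for l l' j
    using that assms by (intro pred_sets2[OF assms] measurable_component_singleton) auto
  show ?thesis
    unfolding barren_arrays_def
    by (rule predE, intro pred_intros_logic(2-5) pred_intros_finite(3,4))
      (auto simp del: One_nat_def intro!: *)
qed

section \<open>Exchangeable laws satisfying the identities\<close>

text \<open>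
  Laws of replica sequences that are invariant under transpositions of replicas and satisfy the
  Ghirlanda-Guerra identities for indicator functions, multiplied by the number of replicas. Only
  the coordinates from 1 on carry information.
\<close>
locale gg_law = prob_space Q
  for Q :: "(nat \<Rightarrow> 'h::{real_inner, polish_space}) measure" +
  assumes sets_Q: "sets Q = sets (replicas {1..} unit_ball)"
    and exchangeable:
      "1 \<le> i \<Longrightarrow> 1 \<le> j \<Longrightarrow> distr Q Q (\<lambda>\<sigma>. \<sigma> \<circ> Transposition.transpose i j) = Q"
    and gg: "2 \<le> N \<Longrightarrow> A \<in> sets (\<Pi>\<^sub>M p\<in>{1..N} \<times> {1..N}. borel) \<Longrightarrow> C \<in> sets borel \<Longrightarrow>
      real N * \<P>(\<sigma> in Q. overlap_array N \<sigma> \<in> A \<and> overlap \<sigma> 1 (N + 1) \<in> C) =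
        \<P>(\<sigma> in Q. overlap_array N \<sigma> \<in> A) * \<P>(\<sigma> in Q. overlap \<sigma> 1 2 \<in> C) +
        (\<Sum>l = 2..N. \<P>(\<sigma> in Q. overlap_array N \<sigma> \<in> A \<and> overlap \<sigma> 1 l \<in> C))"
begin

lemma pred_overlap:
  "1 \<le> i \<Longrightarrow> 1 \<le> j \<Longrightarrow> C \<in> sets borel \<Longrightarrow> Measurable.pred Q (\<lambda>\<sigma>. overlap \<sigma> i j \<in> C)"
  using pred_sets2[OF _ measurable_overlap[of i "{1..}" j]] measurable_cong_sets[OF sets_Q refl]
  by (simp add: measurable_cong_sets[OF sets_Q refl])

lemma pred_overlap_array:
  assumes "A \<in> sets (\<Pi>\<^sub>M p\<in>{1..N} \<times> {1..N}. borel)"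
  shows "Measurable.pred Q (\<lambda>\<sigma>. overlap_array N \<sigma> \<in> A)"
  using pred_sets2[OF assms measurable_overlap_array[of N "{1..}"]]
  by (auto simp: measurable_cong_sets[OF sets_Q refl])

lemma pred_barren:
  assumes "\<And>l. l \<in> {1..n} \<Longrightarrow> B l \<in> sets borel"
  shows "Measurable.pred Q (barren B n k)"
  unfolding barren_iff_array [abs_def]
  by (intro pred_overlap_array sets_barren_arrays assms)

lemma measurable_transpose:
  assumes "1 \<le> i" "1 \<le> j"
  shows "(\<lambda>\<sigma>. \<sigma> \<circ> Transposition.transpose i j) \<in> Q \<rightarrow>\<^sub>M Q"
proof -
  have "(\<lambda>\<sigma>. \<sigma> \<circ> Transposition.transpose i j) \<in> replicas {1..} (unit_ball :: 'h measure) \<rightarrow>\<^sub>M replicas {1..} unit_ball"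
    unfolding replicas_def
  proof (rule measurable_PiM_single')
    fix l :: nat assume "l \<in> {1..}"
    then have "Transposition.transpose i j l \<in> {1..}"
      using assms by (auto simp: Transposition.transpose_def)
    then show "(\<lambda>\<sigma>. (\<sigma> \<circ> Transposition.transpose i j) l) \<in> (\<Pi>\<^sub>M l\<in>{1..}. unit_ball) \<rightarrow>\<^sub>M (unit_ball :: 'h measure)"
      unfolding comp_def by (rule measurable_component_singleton)
  next
    show "(\<lambda>\<sigma> l. (\<sigma> \<circ> Transposition.transpose i j) l) \<in> space (\<Pi>\<^sub>M l\<in>{1..}. (unit_ball :: 'h measure)) \<rightarrow> {1..} \<rightarrow>\<^sub>E space unit_ball"
      using assms by (auto simp: space_PiM PiE_iff extensional_def Transposition.transpose_def)
  qed
  then show ?thesis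
    by (simp add: measurable_cong_sets[OF sets_Q sets_Q])
qed

lemma prob_transpose:
  assumes "1 \<le> i" "1 \<le> j" and P: "Measurable.pred Q P"
  shows "\<P>(\<sigma> in Q. P (\<sigma> \<circ> Transposition.transpose i j)) = \<P>(\<sigma> in Q. P \<sigma>)"
proof -
  let ?T = "\<lambda>\<sigma>. \<sigma> \<circ> Transposition.transpose i j"
  have "\<P>(\<sigma> in Q. P \<sigma>) = measure (distr Q Q ?T) {\<sigma> \<in> space Q. P \<sigma>}"
    using exchangeable[OF assms(1,2)] by simp
  also have "\<dots> = prob (?T -` {\<sigma> \<in> space Q. P \<sigma>} \<inter> space Q)"
    using P by (intro measure_distr measurable_transpose assms) auto
  also have "?T -` {\<sigma> \<in> space Q. P \<sigma>} \<inter> space Q = {\<sigma> \<in> space Q. P (?T \<sigma>)}"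
    using measurable_space[OF measurable_transpose[OF assms(1,2)]] by auto
  finally show ?thesis by simp
qed

text \<open>The identity holds with any replica in the role of the first one.\<close>
lemma gg_index:
  assumes "2 \<le> N" and j: "j \<in> {1..N}"
    and A: "A \<in> sets (\<Pi>\<^sub>M p\<in>{1..N} \<times> {1..N}. borel)" and C: "C \<in> sets borel"
  shows "real N * \<P>(\<sigma> in Q. overlap_array N \<sigma> \<in> A \<and> overlap \<sigma> j (N + 1) \<in> C) =
        \<P>(\<sigma> in Q. overlap_array N \<sigma> \<in> A) * \<P>(\<sigma> in Q. overlap \<sigma> 1 2 \<in> C) +
        (\<Sum>l\<in>{1..N} - {j}. \<P>(\<sigma> in Q. overlap_array N \<sigma> \<in> A \<and> overlap \<sigma> j l \<in> C))"
proof -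
  define t where "t = Transposition.transpose 1 j"
  define S where "S r = (\<lambda>(a, b) \<in> {1..N} \<times> {1..N}. r (t a, t b))" for r :: "nat \<times> nat \<Rightarrow> real"
  let ?\<A> = "\<Pi>\<^sub>M p\<in>{1..N} \<times> {1..N}. (borel :: real measure)"
  have t_in: "t a \<in> {1..N}" if "a \<in> {1..N}" for a
    using that j by (auto simp: t_def Transposition.transpose_def)
  have tt [simp]: "t (t a) = a" for a by (simp add: t_def)
  have t1 [simp]: "t 1 = j" "t (Suc 0) = j" and tj [simp]: "t j = 1"
    and tN [simp]: "t (Suc N) = Suc N"
    using j by (auto simp: t_def Transposition.transpose_def)
  have S: "S \<in> ?\<A> \<rightarrow>\<^sub>M ?\<A>"
    unfolding S_def [abs_def]
    by (intro measurable_restrict) (clarsimp simp del: One_nat_def atLeastAtMost_iff, intro measurable_component_singleton, simp add: t_in del: One_nat_def atLeastAtMost_iff)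
  define A' where "A' = S -` A \<inter> space ?\<A>"
  have A': "A' \<in> sets ?\<A>" unfolding A'_def by (rule measurable_sets[OF S A])
  have arr: "overlap_array N \<sigma> \<in> A' \<longleftrightarrow> overlap_array N (\<sigma> \<circ> t) \<in> A" for \<sigma> :: "nat \<Rightarrow> 'h"
  proof -
    have "overlap_array N \<sigma> \<in> space ?\<A>" by (auto simp: space_PiM overlap_array_def)
    moreover have "S (overlap_array N \<sigma>) = overlap_array N (\<sigma> \<circ> t)"
      using t_in by (auto simp: S_def overlap_array_def overlap_def fun_eq_iff)
    ultimately show ?thesis by (simp add: A'_def)
  qed
  have *: "\<P>(\<sigma> in Q. overlap_array N \<sigma> \<in> A' \<and> overlap \<sigma> 1 l \<in> C) =
      \<P>(\<sigma> in Q. overlap_array N \<sigma> \<in> A \<and> overlap \<sigma> j (t l) \<in> C)" if "1 \<le> l" for l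
  proof -
    have "1 \<le> t l" using that j by (auto simp: t_def Transposition.transpose_def)
    then have "Measurable.pred Q (\<lambda>\<sigma>. overlap_array N \<sigma> \<in> A \<and> overlap \<sigma> j (t l) \<in> C)"
      using j by (intro pred_intros_logic pred_overlap pred_overlap_array A C) auto
    from prob_transpose[OF _ _ this, of 1 j] j show ?thesis
      unfolding t_def[symmetric] arr by (simp add: overlap_def)
  qed
  have **: "\<P>(\<sigma> in Q. overlap_array N \<sigma> \<in> A') = \<P>(\<sigma> in Q. overlap_array N \<sigma> \<in> A)"
    using prob_transpose[OF _ _ pred_overlap_array[OF A], of 1 j] j
    unfolding t_def[symmetric] arr by simp
  have "(\<Sum>l = 2..N. \<P>(\<sigma> in Q. overlap_array N \<sigma> \<in> A' \<and> overlap \<sigma> 1 l \<in> C)) =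
      (\<Sum>l = 2..N. \<P>(\<sigma> in Q. overlap_array N \<sigma> \<in> A \<and> overlap \<sigma> j (t l) \<in> C))"
    by (intro sum.cong *) auto
  also have "\<dots> = (\<Sum>l\<in>{1..N} - {j}. \<P>(\<sigma> in Q. overlap_array N \<sigma> \<in> A \<and> overlap \<sigma> j l \<in> C))"
    using j by (intro sum.reindex_bij_witness[of _ t t])
      (auto simp: t_def Transposition.transpose_def split: if_splits)
  finally show ?thesis
    using gg[OF \<open>2 \<le> N\<close> A' C] *[of "N + 1"] ** by simp
qed


text \<open>
  The main estimate. In the proof \<open>e l k\<close> is the probability that \<open>A\<^sub>k\<close> occurs and the next replica
  has its overlap with replica \<open>l\<close> outside \<open>B\<^sub>l\<close>, and \<open>d k\<close> is the sum of these over \<open>l\<close>.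
\<close>
lemma barren_null:
  assumes "1 \<le> n" and B: "\<And>l. l \<in> {1..n} \<Longrightarrow> B l \<in> sets borel"
    and pos: "\<exists>l\<in>{1..n}. \<P>(\<sigma> in Q. overlap \<sigma> 1 2 \<in> B l) > 0"
  shows "AE \<sigma> in Q. \<not> (\<forall>k. barren B n k \<sigma>)"
proof -
  define a where "a k = \<P>(\<sigma> in Q. barren B n k \<sigma>)" for k
  define e where "e l k = \<P>(\<sigma> in Q. barren B n k \<sigma> \<and> overlap \<sigma> l (n + k + 1) \<in> - B l)" for l k
  define d where "d k = (\<Sum>l\<in>{1..n}. e l k)" for k
  define \<mu> where "\<mu> l = \<P>(\<sigma> in Q. overlap \<sigma> 1 2 \<in> B l)" for l
  define m where "m = (\<Sum>l\<in>{1..n}. \<mu> l)"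
  have B': "- B l \<in> sets borel" if "l \<in> {1..n}" for l
    using B[OF that] by auto
  have ev: "Measurable.pred Q (\<lambda>\<sigma>. barren B n k \<sigma> \<and> overlap \<sigma> l i \<in> - B l)"
    if "l \<in> {1..n}" "1 \<le> i" for k l i
    using that by (intro pred_intros_logic pred_overlap pred_barren B B') auto
  have "0 < m"
    unfolding m_def \<mu>_def using pos by (auto intro!: sum_pos2)
  have "m \<le> real n"
    unfolding m_def \<mu>_def using sum_mono[of "{1..n}" "\<lambda>l. \<P>(\<sigma> in Q. overlap \<sigma> 1 2 \<in> B l)" "\<lambda>_. 1"] by simp
  have a_le: "a (Suc k) \<le> d k" for k
  proof -
    have "a (Suc k) \<le> prob (\<Union>l\<in>{1..n}. {\<sigma> \<in> space Q. barren B n k \<sigma> \<and> overlap \<sigma> l (n + k + 1) \<in> - B l})"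
      unfolding a_def
      by (intro finite_measure_mono sets.finite_UN predE ev) (auto simp: barren_Suc misses_def)
    also have "\<dots> \<le> d k"
      unfolding d_def e_def
      by (intro finite_measure_subadditive_finite) (auto intro!: predE ev simp del: One_nat_def Compl_iff)
    finally show ?thesis .
  qed
  \<comment> \<open>Swapping \<open>i\<close> with the last missing replica preserves the event; for the last one the
      condition of missing is implied by the overlap with \<open>l\<close> and can be dropped.\<close>
  have late: "\<P>(\<sigma> in Q. barren B n (Suc k) \<sigma> \<and> overlap \<sigma> l i \<in> - B l) = e l k"
    if l: "l \<in> {1..n}" and i: "i \<in> {n+1..n + Suc k}" for k l i
  proof -
    define t where "t = Transposition.transpose i (n + Suc k)"
    have t_late: "t x \<in> {n+1..n + Suc k}" if "x \<in> {n+1..n + Suc k}" for x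
      using that i by (auto simp: t_def Transposition.transpose_def)
    have t_early [simp]: "t x = x" if "x \<in> {1..n}" for x
      using that i by (auto simp: t_def Transposition.transpose_def)
    have tt [simp]: "t (t x) = x" for x by (simp add: t_def)
    have ov: "overlap (\<sigma> \<circ> t) x y = overlap \<sigma> (t x) (t y)" for \<sigma> :: "nat \<Rightarrow> 'h" and x y
      by (simp add: overlap_def)
    have "barren B n (Suc k) (\<sigma> \<circ> t) \<longleftrightarrow> barren B n (Suc k) \<sigma>" for \<sigma> :: "nat \<Rightarrow> 'h"
    proof -
      have "mutual B n (\<sigma> \<circ> t) = mutual B n \<sigma>" by (simp add: mutual_def ov)
      moreover have "misses B n (\<sigma> \<circ> t) x = misses B n \<sigma> (t x)" for x by (simp add: misses_def ov)
      ultimately show ?thesis unfolding barren_def using t_late by (metis tt)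
    qed
    moreover have "overlap (\<sigma> \<circ> t) l i = overlap \<sigma> l (n + k + 1)" for \<sigma> :: "nat \<Rightarrow> 'h"
      using l by (simp add: ov) (simp add: t_def)
    ultimately have "\<P>(\<sigma> in Q. barren B n (Suc k) \<sigma> \<and> overlap \<sigma> l i \<in> - B l)
        = \<P>(\<sigma> in Q. barren B n (Suc k) \<sigma> \<and> overlap \<sigma> l (n + k + 1) \<in> - B l)"
      using prob_transpose[of i "n + Suc k", OF _ _ ev[OF l, of i "Suc k"]] i
      unfolding t_def[symmetric] by simp
    also have "\<dots> = e l k"
      unfolding e_def barren_Suc misses_def using l by (intro arg_cong[where f = prob]) auto
    finally show ?thesis .
  qed
  have step: "real (n + 1 + k) * e l (Suc k) = a (Suc k) * (1 - \<mu> l) + real (k + 1) * e l k"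
    if l: "l \<in> {1..n}" for l k
  proof -
    let ?N = "n + Suc k"
    let ?p = "\<lambda>j. \<P>(\<sigma> in Q. barren B n (Suc k) \<sigma> \<and> overlap \<sigma> l j \<in> - B l)"
    have early: "?p j = 0" if "j \<in> {1..n} - {l}" for j
    proof -
      have "{\<sigma> \<in> space Q. barren B n (Suc k) \<sigma> \<and> overlap \<sigma> l j \<in> - B l} = {}"
        using mutualD[of B n _ l j] that l by (auto simp: barren_def)
      then show ?thesis by (simp only: measure_empty)
    qed
    \<comment> \<open>Here \<open>?N \<ge> 2\<close> even for \<open>n = 1\<close>, since the event involves at least one missing replica.\<close>
    have "real ?N * ?p (?N + 1) = a (Suc k) * \<P>(\<sigma> in Q. overlap \<sigma> 1 2 \<in> - B l) + (\<Sum>j\<in>{1..?N} - {l}. ?p j)"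
      unfolding a_def barren_iff_array using l
      by (intro gg_index sets_barren_arrays B B') auto
    also have "\<P>(\<sigma> in Q. overlap \<sigma> 1 2 \<in> - B l) = 1 - \<mu> l"
      using prob_neg[of "\<lambda>\<sigma>. overlap \<sigma> 1 2 \<in> B l"] pred_overlap[of 1 2 "B l"] B[OF l]
      by (simp add: \<mu>_def)
    also have "(\<Sum>j\<in>{1..?N} - {l}. ?p j) = (\<Sum>j\<in>{n+1..?N}. ?p j)"
      using l by (intro sum.mono_neutral_right) (auto intro!: early simp del: Compl_iff)
    also have "\<dots> = real (k + 1) * e l k"
      using late[OF l] by simp
    finally show ?thesis by (simp add: e_def)
  qed
  have lim: "d \<longlonglongrightarrow> 0"
  proof (rule harmonic_recursion_tendsto_0[OF \<open>0 < m\<close>, of "n + 1"])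
    show "0 \<le> d k" for k
      by (auto simp: d_def e_def intro!: sum_nonneg)
    fix k
    have "real (n + 1 + k) * d (Suc k) = (\<Sum>l\<in>{1..n}. a (Suc k) * (1 - \<mu> l) + real (k + 1) * e l k)"
      unfolding d_def sum_distrib_left by (intro sum.cong step refl)
    also have "\<dots> = a (Suc k) * (real n - m) + real (k + 1) * d k"
      by (simp only: sum.distrib sum_distrib_left[symmetric] sum_subtractf d_def m_def) simp
    also have "\<dots> \<le> d k * (real n - m) + real (k + 1) * d k"
      using a_le[of k] \<open>m \<le> real n\<close> by (intro add_right_mono mult_right_mono) auto
    finally show "real (n + 1 + k) * d (Suc k) \<le> (real (n + 1 + k) - m) * d k"
      by (simp add: algebra_simps)
  qed simp
  have null: "\<P>(\<sigma> in Q. \<forall>k. barren B n k \<sigma>) \<le> d k" for k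
  proof -
    have "\<P>(\<sigma> in Q. \<forall>k. barren B n k \<sigma>) \<le> a (Suc k)"
      unfolding a_def by (intro finite_measure_mono predE pred_barren B) auto
    with a_le[of k] show ?thesis by linarith
  qed
  have "\<P>(\<sigma> in Q. \<forall>k. barren B n k \<sigma>) \<le> 0"
    by (rule LIMSEQ_le_const[OF lim]) (use null in blast)
  then have "\<P>(\<sigma> in Q. \<forall>k. barren B n k \<sigma>) = 0"
    by (simp add: measure_le_0_iff)
  moreover have "{\<sigma> \<in> space Q. \<forall>k. barren B n k \<sigma>} \<in> events"
    by (intro predE pred_intros_countable pred_barren B)
  ultimately have "{\<sigma> \<in> space Q. \<forall>k. barren B n k \<sigma>} \<in> null_sets Q"
    by (simp add: null_sets_def emeasure_eq_measure)
  then show ?thesis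
    by (rule AE_I') auto
qed

end


section \<open>The averaged law of the replicas\<close>

text \<open>A random measure yields a random product measure, measurably, also for infinitely many factors.\<close>
lemma measurable_replicas:
  assumes G: "G \<in> P \<rightarrow>\<^sub>M prob_algebra M"
  shows "(\<lambda>\<omega>. replicas I (G \<omega>)) \<in> P \<rightarrow>\<^sub>M prob_algebra (replicas I M)"
  unfolding replicas_def
proof (rule measurable_prob_algebra_generated[OF sets_PiM Int_stable_prod_algebra prod_algebra_sets_into_space])
  fix \<omega> assume "\<omega> \<in> space P"
  then have "G \<omega> \<in> space (prob_algebra M)" by (rule measurable_space[OF G])
  then have G\<omega>: "prob_space (G \<omega>)" "sets (G \<omega>) = sets M" by (auto simp: space_prob_algebra)
  show "prob_space (\<Pi>\<^sub>M i\<in>I. G \<omega>)" by (intro prob_space_PiM G\<omega>)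
  show "sets (\<Pi>\<^sub>M i\<in>I. G \<omega>) = sets (\<Pi>\<^sub>M i\<in>I. M)" by (intro sets_PiM_cong refl G\<omega>)
next
  fix A assume "A \<in> prod_algebra I (\<lambda>_. M)"
  then obtain J E where A: "A = prod_emb I (\<lambda>_. M) J (Pi\<^sub>E J E)" and J: "finite J" "J \<subseteq> I"
    and E: "\<And>i. i \<in> J \<Longrightarrow> E i \<in> sets M"
    by (rule prod_algebraE) blast
  have "emeasure (\<Pi>\<^sub>M i\<in>I. G \<omega>) A = (\<Prod>i\<in>J. emeasure (G \<omega>) (E i))" if "\<omega> \<in> space P" for \<omega>
  proof -
    have "G \<omega> \<in> space (prob_algebra M)" using that by (rule measurable_space[OF G])
    then have G\<omega>: "prob_space (G \<omega>)" "sets (G \<omega>) = sets M" by (auto simp: space_prob_algebra)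
    then have "A = prod_emb I (\<lambda>_. G \<omega>) J (Pi\<^sub>E J E)"
      using sets_eq_imp_space_eq[OF G\<omega>(2)] by (simp add: A prod_emb_def)
    with G\<omega> J E show ?thesis by (simp add: emeasure_PiM_emb)
  qed
  moreover have "(\<lambda>\<omega>. \<Prod>i\<in>J. emeasure (G \<omega>) (E i)) \<in> borel_measurable P"
    using E by (intro borel_measurable_prod_ennreal
      measurable_compose[OF measurable_prob_algebraD[OF G] measurable_emeasure_subprob_algebra]) auto
  ultimately show "(\<lambda>\<omega>. emeasure (\<Pi>\<^sub>M i\<in>I. G \<omega>) A) \<in> borel_measurable P"
    by (subst measurable_cong) auto
qed

lemma replicas_reindex:
  assumes M: "prob_space M" and f: "inj_on f I" "f \<in> I \<rightarrow> J"
  shows "distr (replicas J M) (replicas I M) (\<lambda>\<sigma>. \<lambda>l\<in>I. \<sigma> (f l)) = replicas I M"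
  unfolding replicas_def using distr_PiM_reindex[of J "\<lambda>_. M" f I] assms by simp

lemma replicas_restrict:
  assumes "prob_space M" and "I \<subseteq> J"
  shows "distr (replicas J M) (replicas I M) (\<lambda>\<sigma>. restrict \<sigma> I) = replicas I M"
  using replicas_reindex[OF assms(1), of "\<lambda>l. l" I J] assms(2) by (auto simp: restrict_def)

locale random_measure =
  fixes P :: "'w measure" and G :: "'w \<Rightarrow> 'h::{real_inner, polish_space} measure"
  assumes random: "random_prob_measure P G"
begin

text \<open>The law \<open>\<E>G\<^bsup>\<otimes>\<infinity>\<^esup>\<close> of the sequence of replicas.\<close>
definition averaged_law :: "(nat \<Rightarrow> 'h) measure" where
  "averaged_law = P \<bind> (\<lambda>\<omega>. replicas {1..} (G \<omega>))"

sublocale P: prob_space P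
  using random by (simp add: random_prob_measure_def)

lemma G_measurable: "G \<in> P \<rightarrow>\<^sub>M prob_algebra unit_ball"
  using random by (simp add: random_prob_measure_def)

lemma G_fibre:
  assumes "\<omega> \<in> space P"
  shows "prob_space (G \<omega>)" "sets (G \<omega>) = sets unit_ball"
  using measurable_space[OF G_measurable assms] by (auto simp: space_prob_algebra)

lemma sets_replicas_G: "\<omega> \<in> space P \<Longrightarrow> sets (replicas I (G \<omega>)) = sets (replicas I unit_ball)"
  unfolding replicas_def by (intro sets_PiM_cong refl G_fibre)

lemma kernel: "(\<lambda>\<omega>. replicas I (G \<omega>)) \<in> P \<rightarrow>\<^sub>M subprob_algebra (replicas I unit_ball)"
  by (intro measurable_prob_algebraD measurable_replicas G_measurable)

lemma sets_averaged_law: "sets averaged_law = sets (replicas {1..} unit_ball)"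
  unfolding averaged_law_def by (rule sets_bind[OF sets_replicas_G P.not_empty])

lemma prob_space_averaged_law: "prob_space averaged_law"
  unfolding averaged_law_def
  by (rule prob_space_bind'[OF _ measurable_replicas[OF G_measurable]])
    (simp add: space_prob_algebra P.prob_space_axioms)

lemma averaged_expectation_eq:
  assumes "F \<in> borel_measurable (replicas {1..} unit_ball)" and "\<And>\<sigma>. \<bar>F \<sigma>\<bar> \<le> c"
  shows "averaged_expectation P G F = (\<integral>\<sigma>. F \<sigma> \<partial>averaged_law)"
proof -
  have "emeasure (replicas {1..} (G \<omega>)) (space (replicas {1..} (G \<omega>))) \<le> ennreal 1" if "\<omega> \<in> space P" for \<omega>
    using prob_space.emeasure_space_1[OF prob_space_PiM[of "{1::nat..}" "\<lambda>_. G \<omega>"]] G_fibre[OF that]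
    by (simp add: replicas_def del: One_nat_def)
  then show ?thesis
    unfolding averaged_expectation_def averaged_law_def
    by (intro integral_bind[symmetric, OF assms kernel P.finite_measure AE_I2])
qed

lemma averaged_expectation_prob:
  assumes "Measurable.pred (replicas {1..} unit_ball) E" and "\<And>\<sigma>. F \<sigma> = indicator {\<sigma>. E \<sigma>} \<sigma>"
  shows "averaged_expectation P G F = \<P>(\<sigma> in averaged_law. E \<sigma>)"
proof -
  have F: "F = (\<lambda>\<sigma>. indicator {\<sigma>. E \<sigma>} \<sigma>)" using assms(2) by blast
  have "averaged_expectation P G F = (\<integral>\<sigma>. F \<sigma> \<partial>averaged_law)"
  proof (rule averaged_expectation_eq)
    show "F \<in> borel_measurable (replicas {1..} unit_ball)"
      unfolding F using assms(1) by measurable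
    show "\<bar>F \<sigma>\<bar> \<le> 1" for \<sigma> by (simp add: F indicator_def)
  qed
  also have "\<dots> = \<P>(\<sigma> in averaged_law. E \<sigma>)"
    unfolding F by (simp add: Int_def conj_commute)
  finally show ?thesis .
qed

lemma exchangeable_averaged_law:
  assumes "1 \<le> i" "1 \<le> j"
  shows "distr averaged_law averaged_law (\<lambda>\<sigma>. \<sigma> \<circ> Transposition.transpose i j) = averaged_law"
proof -
  let ?t = "Transposition.transpose i j"
  have t: "?t l \<in> {1..} \<longleftrightarrow> l \<in> {1..}" for l
    using assms by (auto simp: Transposition.transpose_def)
  let ?T = "\<lambda>\<sigma>. \<lambda>l\<in>{1..}. \<sigma> (?t l)"
  have T: "?T \<in> replicas {1..} unit_ball \<rightarrow>\<^sub>M replicas {1..} (unit_ball :: 'h measure)"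
    unfolding replicas_def
    by (intro measurable_restrict measurable_component_singleton) (simp only: t)
  have "distr averaged_law averaged_law (\<lambda>\<sigma>. \<sigma> \<circ> ?t) = distr averaged_law (replicas {1..} unit_ball) ?T"
  proof (rule distr_cong)
    fix \<sigma> assume "\<sigma> \<in> space averaged_law"
    then have "\<sigma> \<in> extensional {1..}"
      using sets_eq_imp_space_eq[OF sets_averaged_law] by (simp add: replicas_def space_PiM PiE_def)
    then show "\<sigma> \<circ> ?t = ?T \<sigma>"
      using t by (auto simp: fun_eq_iff extensional_def restrict_def)
  qed (auto simp: sets_averaged_law)
  also have "\<dots> = P \<bind> (\<lambda>\<omega>. distr (replicas {1..} (G \<omega>)) (replicas {1..} unit_ball) ?T)"
    unfolding averaged_law_def by (rule distr_bind[OF kernel P.not_empty T])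
  also have "\<dots> = averaged_law"
    unfolding averaged_law_def
  proof (rule bind_cong[OF refl])
    fix \<omega> assume \<omega>: "\<omega> \<in> space P"
    have "distr (replicas {1..} (G \<omega>)) (replicas {1..} unit_ball) ?T
        = distr (replicas {1..} (G \<omega>)) (replicas {1..} (G \<omega>)) ?T"
      using sets_replicas_G[OF \<omega>] by (intro distr_cong) auto
    also have "\<dots> = replicas {1..} (G \<omega>)"
      using t by (intro replicas_reindex G_fibre \<omega>) auto
    finally show "distr (replicas {1..} (G \<omega>)) (replicas {1..} unit_ball) ?T = replicas {1..} (G \<omega>)" .
  qed
  finally show ?thesis .
qed

lemma overlap_law_eq:
  assumes C: "C \<in> sets borel"
  shows "measure (overlap_law P G) C = \<P>(\<sigma> in averaged_law. overlap \<sigma> 1 2 \<in> C)"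
proof -
  let ?r = "\<lambda>\<sigma>. restrict \<sigma> {1..2}"
  have r: "?r \<in> replicas {1..} unit_ball \<rightarrow>\<^sub>M replicas {1..2} (unit_ball :: 'h measure)"
    unfolding replicas_def by (intro measurable_restrict_subset) auto
  have o: "(\<lambda>\<sigma>. overlap \<sigma> 1 2) \<in> borel_measurable (replicas {1..2} (unit_ball :: 'h measure))"
    by (intro measurable_overlap) auto
  have meas: "(\<lambda>\<sigma>. overlap \<sigma> 1 2) \<in> borel_measurable averaged_law"
    by (subst measurable_cong_sets[OF sets_averaged_law refl], rule measurable_overlap) auto
  have "P \<bind> (\<lambda>\<omega>. replicas {1..2} (G \<omega>))
      = P \<bind> (\<lambda>\<omega>. distr (replicas {1..} (G \<omega>)) (replicas {1..2} unit_ball) ?r)"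
  proof (rule bind_cong[OF refl])
    fix \<omega> assume \<omega>: "\<omega> \<in> space P"
    have "replicas {1..2} (G \<omega>) = distr (replicas {1..} (G \<omega>)) (replicas {1..2} (G \<omega>)) ?r"
      by (intro replicas_restrict[symmetric] G_fibre \<omega>) auto
    also have "\<dots> = distr (replicas {1..} (G \<omega>)) (replicas {1..2} unit_ball) ?r"
      by (intro distr_cong refl sets_replicas_G \<omega>)
    finally show "replicas {1..2} (G \<omega>) = distr (replicas {1..} (G \<omega>)) (replicas {1..2} unit_ball) ?r" .
  qed
  also have "\<dots> = distr averaged_law (replicas {1..2} unit_ball) ?r"
    unfolding averaged_law_def by (rule distr_bind[symmetric, OF kernel P.not_empty r])
  finally have "overlap_law P G = distr averaged_law borel ((\<lambda>\<sigma>. overlap \<sigma> 1 2) \<circ> ?r)"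
    unfolding overlap_law_def using r o
    by (simp add: distr_distr measurable_cong_sets[OF sets_averaged_law refl])
  also have "((\<lambda>\<sigma>. overlap \<sigma> 1 2) \<circ> ?r) = (\<lambda>\<sigma> :: nat \<Rightarrow> 'h. overlap \<sigma> 1 2)"
    by (auto simp: fun_eq_iff overlap_def)
  finally have "measure (overlap_law P G) C
      = measure averaged_law ((\<lambda>\<sigma>. overlap \<sigma> 1 2) -` C \<inter> space averaged_law)"
    by (simp only: measure_distr[OF meas C])
  then show ?thesis by (simp add: vimage_def Int_def conj_commute)
qed

lemma gg_law_averaged_law:
  assumes "ghirlanda_guerra P G"
  shows "gg_law averaged_law"
proof -
  interpret prob_space averaged_law by (rule prob_space_averaged_law)
  show ?thesis
  proof
    show "sets averaged_law = sets (replicas {1..} unit_ball)" by (rule sets_averaged_law)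
    show "distr averaged_law averaged_law (\<lambda>\<sigma>. \<sigma> \<circ> Transposition.transpose i j) = averaged_law"
      if "1 \<le> i" "1 \<le> j" for i j
      using that by (rule exchangeable_averaged_law)
  next
    fix N :: nat and A :: "(nat \<times> nat \<Rightarrow> real) set" and C :: "real set"
    assume N: "2 \<le> N" and A: "A \<in> sets (\<Pi>\<^sub>M p\<in>{1..N} \<times> {1..N}. borel)" and C: "C \<in> sets borel"
    let ?f = "indicator A :: _ \<Rightarrow> real" and ?g = "indicator C :: _ \<Rightarrow> real"
    have bdd: "bounded (range ?f)" "bounded (range ?g)"
      by (auto simp: bounded_iff indicator_def intro!: exI[of _ 1])
    have arr: "Measurable.pred (replicas {1..} unit_ball) (\<lambda>\<sigma>. overlap_array N \<sigma> \<in> A)"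
      by (intro pred_sets2[OF A] measurable_overlap_array) auto
    have ov: "Measurable.pred (replicas {1..} unit_ball) (\<lambda>\<sigma>. overlap \<sigma> 1 l \<in> C)" if "1 \<le> l" for l
      using that by (intro pred_sets2[OF C] measurable_overlap) auto
    have e1: "averaged_expectation P G (\<lambda>\<sigma>. ?f (overlap_array N \<sigma>) * ?g (overlap \<sigma> 1 l))
        = \<P>(\<sigma> in averaged_law. overlap_array N \<sigma> \<in> A \<and> overlap \<sigma> 1 l \<in> C)" if "1 \<le> l" for l
      by (rule averaged_expectation_prob)
        (auto intro!: pred_intros_logic(3) arr ov that simp del: One_nat_def simp: indicator_def)
    have e2: "averaged_expectation P G (\<lambda>\<sigma>. ?f (overlap_array N \<sigma>))
        = \<P>(\<sigma> in averaged_law. overlap_array N \<sigma> \<in> A)"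
      by (rule averaged_expectation_prob[OF arr]) (simp add: indicator_def)
    have e3: "averaged_expectation P G (\<lambda>\<sigma>. ?g (overlap \<sigma> 1 2))
        = \<P>(\<sigma> in averaged_law. overlap \<sigma> 1 2 \<in> C)"
      by (rule averaged_expectation_prob[OF ov]) (simp_all add: indicator_def)
    have "averaged_expectation P G (\<lambda>\<sigma>. ?f (overlap_array N \<sigma>) * ?g (overlap \<sigma> 1 (N + 1))) =
        1 / real N * averaged_expectation P G (\<lambda>\<sigma>. ?f (overlap_array N \<sigma>))
          * averaged_expectation P G (\<lambda>\<sigma>. ?g (overlap \<sigma> 1 2))
        + 1 / real N * (\<Sum>l = 2..N.
            averaged_expectation P G (\<lambda>\<sigma>. ?f (overlap_array N \<sigma>) * ?g (overlap \<sigma> 1 l)))"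
      using assms[unfolded ghirlanda_guerra_def, rule_format, OF N _ _ bdd] A C
      by (simp add: borel_measurable_indicator)
    also have "(\<Sum>l = 2..N. averaged_expectation P G (\<lambda>\<sigma>. ?f (overlap_array N \<sigma>) * ?g (overlap \<sigma> 1 l)))
        = (\<Sum>l = 2..N. \<P>(\<sigma> in averaged_law. overlap_array N \<sigma> \<in> A \<and> overlap \<sigma> 1 l \<in> C))"
      by (intro sum.cong e1) auto
    finally show "real N * \<P>(\<sigma> in averaged_law. overlap_array N \<sigma> \<in> A \<and> overlap \<sigma> 1 (N + 1) \<in> C) =
        \<P>(\<sigma> in averaged_law. overlap_array N \<sigma> \<in> A) * \<P>(\<sigma> in averaged_law. overlap \<sigma> 1 2 \<in> C) +
        (\<Sum>l = 2..N. \<P>(\<sigma> in averaged_law. overlap_array N \<sigma> \<in> A \<and> overlap \<sigma> 1 l \<in> C))"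
      using N by (subst (asm) e1, simp) (simp add: e2 e3 field_simps del: One_nat_def)
  qed
qed

end

section \<open>Positive measure in almost every fibre\<close>

text \<open>
  For a fixed measure \<open>M\<close>: where the hitting set is null, every later replica misses almost surely,
  so the sample lies in every \<open>A\<^sub>k\<close>.
\<close>
lemma AE_barren_imp_positive:
  fixes M :: "'h::{real_inner, polish_space} measure"
  assumes M: "prob_space M" and sets_M: "sets M = sets unit_ball"
    and B: "\<And>l. l \<in> {1..n} \<Longrightarrow> B l \<in> sets borel"
    and not_barren: "AE \<sigma> in replicas {1..} M. \<not> (\<forall>k. barren B n k \<sigma>)"
  shows "AE \<sigma> in replicas {1..n} M. mutual B n \<sigma> \<longrightarrow>
    measure M {\<tau> \<in> space M. \<forall>l\<in>{1..n}. \<tau> \<bullet> \<sigma> l \<in> B l} > 0"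
proof -
  interpret M: prob_space M by (rule M)
  let ?R = "replicas {1..n} M"
  interpret R: prob_space ?R
    unfolding replicas_def by (intro prob_space_PiM M)
  interpret MR: pair_sigma_finite M ?R ..
  define hit where "hit \<sigma> \<tau> \<longleftrightarrow> (\<forall>l\<in>{1..n}. \<tau> \<bullet> \<sigma> l \<in> B l)" for \<sigma> :: "nat \<Rightarrow> 'h" and \<tau>
  define p where "p \<sigma> = measure M {\<tau> \<in> space M. hit \<sigma> \<tau>}" for \<sigma>
  have id_M: "(\<lambda>x. x) \<in> M \<rightarrow>\<^sub>M borel"
    using measurable_unit_ball by (simp add: measurable_cong_sets[OF sets_M refl])
  have coord: "(\<lambda>\<sigma>. \<sigma> l) \<in> ?R \<rightarrow>\<^sub>M borel" if "l \<in> {1..n}" for l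
    unfolding replicas_def
    by (rule measurable_compose[OF _ id_M]) (rule measurable_component_singleton[OF that])
  have overlap_M: "(\<lambda>\<sigma>. overlap \<sigma> l l') \<in> borel_measurable (replicas I M)" if "l \<in> I" "l' \<in> I" for l l' I
  proof -
    have "sets (replicas I M) = sets (replicas I unit_ball)"
      unfolding replicas_def by (intro sets_PiM_cong refl sets_M)
    then show ?thesis
      using measurable_overlap[OF that] measurable_cong_sets by blast
  qed
  have hit_pred: "Measurable.pred (?R \<Otimes>\<^sub>M M) (\<lambda>x. hit (fst x) (snd x))"
    unfolding hit_def
  proof (intro pred_intros_finite(3) finite_atLeastAtMost)
    fix l assume l: "l \<in> {1..n}"
    show "Measurable.pred (?R \<Otimes>\<^sub>M M) (\<lambda>x. snd x \<bullet> fst x l \<in> B l)"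
      by (intro pred_sets2[OF B[OF l]] borel_measurable_inner
          measurable_compose[OF measurable_snd id_M] measurable_compose[OF measurable_fst coord[OF l]])
  qed
  have p_meas: "p \<in> borel_measurable ?R"
  proof -
    have "(\<lambda>\<sigma>. emeasure M {\<tau> \<in> space M. hit \<sigma> \<tau>}) \<in> borel_measurable ?R"
    proof (rule M.measurable_emeasure)
      have "{x \<in> space (?R \<Otimes>\<^sub>M M). snd x \<in> {\<tau> \<in> space M. hit (fst x) \<tau>}}
          = {x \<in> space (?R \<Otimes>\<^sub>M M). hit (fst x) (snd x)}"
        by (auto simp: space_pair_measure)
      with hit_pred show "{x \<in> space (?R \<Otimes>\<^sub>M M). snd x \<in> {\<tau> \<in> space M. hit (fst x) \<tau>}} \<in> sets (?R \<Otimes>\<^sub>M M)"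
        by (simp add: pred_def)
    qed auto
    then show ?thesis unfolding p_def [abs_def] measure_def by measurable
  qed
  \<comment> \<open>Replica \<open>i\<close> is independent of the first \<open>n\<close>, which reduces the claim to Fubini
      for the product of \<open>M\<close> with their law.\<close>
  have fresh: "AE \<sigma> in replicas {1..} M. p (restrict \<sigma> {1..n}) = 0 \<longrightarrow> misses B n \<sigma> i" if i: "n < i" for i
  proof -
    let ?J = "insert i {1..n}"
    let ?E = "\<lambda>\<sigma>. p (restrict \<sigma> {1..n}) = 0 \<longrightarrow> misses B n \<sigma> i"
    have fibre: "AE \<sigma> in ?R. AE \<tau> in M. p \<sigma> = 0 \<longrightarrow> \<not> hit \<sigma> \<tau>"
    proof (rule AE_I2)
      fix \<sigma> assume \<sigma>: "\<sigma> \<in> space ?R"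
      have "{\<tau> \<in> space M. hit \<sigma> \<tau>} \<in> sets M"
        using measurable_compose[OF measurable_Pair1'[OF \<sigma>] hit_pred] by (simp add: pred_def)
      then show "AE \<tau> in M. p \<sigma> = 0 \<longrightarrow> \<not> hit \<sigma> \<tau>"
        by (cases "p \<sigma> = 0") (auto simp: p_def M.prob_eq_0)
    qed
    have null_set: "{x \<in> space (M \<Otimes>\<^sub>M ?R). p (snd x) = 0 \<longrightarrow> \<not> hit (snd x) (fst x)} \<in> sets (M \<Otimes>\<^sub>M ?R)"
    proof (rule predE, intro pred_intros_logic(2,4))
      show "Measurable.pred (M \<Otimes>\<^sub>M ?R) (\<lambda>x. p (snd x) = 0)"
        by (intro pred_eq_const1[of _ _ borel] measurable_compose[OF measurable_snd p_meas]) simp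
      show "Measurable.pred (M \<Otimes>\<^sub>M ?R) (\<lambda>x. hit (snd x) (fst x))"
        using measurable_compose[OF measurable_pair_swap' hit_pred] by (simp add: case_prod_beta)
    qed
    have ae: "AE x in M \<Otimes>\<^sub>M ?R. p (snd x) = 0 \<longrightarrow> \<not> hit (snd x) (fst x)"
      using fibre unfolding MR.AE_commute[OF null_set, symmetric] MR.AE_pair_iff[OF null_set] .
    let ?u = "\<lambda>(\<tau>, \<sigma>). \<sigma>(i := \<tau>)"
    have u: "?u \<in> M \<Otimes>\<^sub>M ?R \<rightarrow>\<^sub>M replicas ?J M"
      unfolding replicas_def case_prod_beta
      by (rule measurable_fun_upd[where J = "{1..n}"]) auto
    have "AE x in M \<Otimes>\<^sub>M ?R. ?E (?u x)"
      using ae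
    proof (rule AE_mp, intro AE_I2 impI)
      fix x assume x: "x \<in> space (M \<Otimes>\<^sub>M ?R)" and *: "p (snd x) = 0 \<longrightarrow> \<not> hit (snd x) (fst x)"
        and 0: "p (restrict (?u x) {1..n}) = 0"
      have "snd x \<in> extensional {1..n}"
        using x by (auto simp: space_pair_measure replicas_def space_PiM PiE_def)
      with i have "restrict (?u x) {1..n} = snd x"
        by (auto simp: fun_eq_iff extensional_def restrict_def case_prod_beta)
      with * 0 have "\<not> hit (snd x) (fst x)" by simp
      with i show "misses B n (?u x) i"
        by (auto simp: misses_def hit_def overlap_def case_prod_beta inner_commute)
    qed
    moreover have "{\<sigma> \<in> space (replicas ?J M). ?E \<sigma>} \<in> sets (replicas ?J M)"
    proof (rule predE, intro pred_intros_logic(4))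
      show "Measurable.pred (replicas ?J M) (\<lambda>\<sigma>. p (restrict \<sigma> {1..n}) = 0)"
        by (intro pred_eq_const1[of _ _ borel] measurable_compose[OF _ p_meas])
          (auto simp: replicas_def intro!: measurable_restrict_subset)
      show "Measurable.pred (replicas ?J M) (\<lambda>\<sigma>. misses B n \<sigma> i)"
        unfolding misses_def
        by (intro pred_intros_finite(4) pred_intros_logic(2) finite_atLeastAtMost pred_sets2[OF B] overlap_M) auto
    qed
    ultimately have "AE \<sigma> in distr (M \<Otimes>\<^sub>M ?R) (replicas ?J M) ?u. ?E \<sigma>"
      by (simp only: AE_distr_iff[OF u])
    also have "distr (M \<Otimes>\<^sub>M ?R) (replicas ?J M) ?u = replicas ?J M"
      unfolding replicas_def by (intro distr_pair_PiM_eq_PiM M)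
    finally have "AE \<sigma> in replicas ?J M. ?E \<sigma>" .
    then have "AE \<sigma> in distr (replicas {1..} M) (replicas ?J M) (\<lambda>\<sigma>. restrict \<sigma> ?J). ?E \<sigma>"
      using i by (subst replicas_restrict[OF M]) auto
    then have "AE \<sigma> in replicas {1..} M. ?E (restrict \<sigma> ?J)"
    proof (rule AE_distrD[rotated])
      show "(\<lambda>\<sigma>. restrict \<sigma> ?J) \<in> replicas {1..} M \<rightarrow>\<^sub>M replicas ?J M"
        unfolding replicas_def using i by (intro measurable_restrict_subset) auto
    qed
    moreover have "?E (restrict \<sigma> ?J) \<longleftrightarrow> ?E \<sigma>" for \<sigma>
      by (simp add: misses_def overlap_def Int_absorb1 subset_insertI)
    ultimately show ?thesis by simp
  qed
  then have "AE \<sigma> in replicas {1..} M. \<forall>i. n < i \<longrightarrow> p (restrict \<sigma> {1..n}) = 0 \<longrightarrow> misses B n \<sigma> i"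
    by (simp add: AE_all_countable)
  with not_barren have "AE \<sigma> in replicas {1..} M. mutual B n \<sigma> \<longrightarrow> p (restrict \<sigma> {1..n}) \<noteq> 0"
    by eventually_elim (auto simp: barren_def)
  then have "AE \<sigma> in replicas {1..} M. mutual B n (restrict \<sigma> {1..n}) \<longrightarrow> 0 < p (restrict \<sigma> {1..n})"
    by eventually_elim (auto simp: mutual_def overlap_def p_def zero_less_measure_iff)
  moreover have "(\<lambda>\<sigma>. restrict \<sigma> {1..n}) \<in> replicas {1..} M \<rightarrow>\<^sub>M ?R"
    unfolding replicas_def by (intro measurable_restrict_subset) auto
  moreover have "{\<sigma> \<in> space ?R. mutual B n \<sigma> \<longrightarrow> 0 < p \<sigma>} \<in> sets ?R"
  proof (rule predE, intro pred_intros_logic(4))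
    show "Measurable.pred ?R (mutual B n)"
      unfolding mutual_def
      by (intro pred_intros_finite(3) pred_intros_logic(2,4) finite_atLeastAtMost
          pred_sets2[OF sets.Int[OF B B]] overlap_M) auto
    show "Measurable.pred ?R (\<lambda>\<sigma>. 0 < p \<sigma>)"
      using p_meas by measurable
  qed
  ultimately have "AE \<sigma> in distr (replicas {1..} M) ?R (\<lambda>\<sigma>. restrict \<sigma> {1..n}). mutual B n \<sigma> \<longrightarrow> 0 < p \<sigma>"
    by (simp only: AE_distr_iff)
  then show ?thesis
    by (subst (asm) replicas_restrict[OF M]) (auto simp: p_def hit_def)
qed

theorem corollary1:
  fixes P :: "'w measure"
    and G :: "'w \<Rightarrow> 'h::{real_inner, polish_space} measure"
    and n :: nat
    and B :: "nat \<Rightarrow> real set"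
  assumes "random_prob_measure P G"
    and "ghirlanda_guerra P G"
    and "n \<ge> 1"
    and "\<forall>l\<in>{1..n}. B l \<in> sets borel"
    and "\<exists>l\<in>{1..n}. measure (overlap_law P G) (B l) > 0"
  shows "AE \<omega> in P. AE \<sigma> in replicas {1..n} (G \<omega>).
           (\<forall>l\<in>{1..n}. \<forall>l'\<in>{1..n}. l \<noteq> l' \<longrightarrow> overlap \<sigma> l l' \<in> B l \<inter> B l') \<longrightarrow>
           measure (G \<omega>) {\<tau> \<in> space (G \<omega>). \<forall>l\<in>{1..n}. \<tau> \<bullet> \<sigma> l \<in> B l} > 0"
proof -
  interpret random_measure P G by standard (rule assms(1))
  interpret gg_law averaged_law by (rule gg_law_averaged_law[OF assms(2)])
  have B: "B l \<in> sets borel" if "l \<in> {1..n}" for l using assms(4) that by blast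
  obtain l where l: "l \<in> {1..n}" "measure (overlap_law P G) (B l) > 0"
    using assms(5) by blast
  then have "\<exists>l\<in>{1..n}. \<P>(\<sigma> in averaged_law. overlap \<sigma> 1 2 \<in> B l) > 0"
    unfolding overlap_law_eq[OF B[OF l(1)]] by (rule bexI[rotated])
  then have "AE \<sigma> in averaged_law. \<not> (\<forall>k. barren B n k \<sigma>)"
    by (intro barren_null assms(3) B)
  moreover have "Measurable.pred (replicas {1..} unit_ball) (\<lambda>\<sigma> :: nat \<Rightarrow> 'h. \<not> (\<forall>k. barren B n k \<sigma>))"
    using pred_intros_logic(2)[OF pred_intros_countable(1)[OF pred_barren[OF B]]]
    by (simp only: measurable_cong_sets[OF sets_averaged_law refl])
  ultimately have ae: "AE \<omega> in P. AE \<sigma> in replicas {1..} (G \<omega>). \<not> (\<forall>k. barren B n k \<sigma>)"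
    unfolding averaged_law_def by (simp only: AE_bind[OF kernel])
  show ?thesis
    unfolding mutual_def[symmetric]
  proof (rule AE_mp[OF ae], rule AE_I2, rule impI)
    fix \<omega> assume "\<omega> \<in> space P" and "AE \<sigma> in replicas {1..} (G \<omega>). \<not> (\<forall>k. barren B n k \<sigma>)"
    then show "AE \<sigma> in replicas {1..n} (G \<omega>). mutual B n \<sigma> \<longrightarrow>
        measure (G \<omega>) {\<tau> \<in> space (G \<omega>). \<forall>l\<in>{1..n}. \<tau> \<bullet> \<sigma> l \<in> B l} > 0"
      by (intro AE_barren_imp_positive G_fibre B)
  qed
qed

end
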